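(* Let $G=(V,E)$ be a finite simple graph with at least two vertices and no isolated vertices, and let $\partial V\subseteq V$ be any designated set of boundary vertices. Let $\mathcal{L}_R$ be the normalized reflected Neumann graph Laplacian of $(G,\partial V)$, let $\lambda_R$ be its first nontrivial eigenvalue, and let $m$ and $\operatorname{vol}$ be the edge measure and volume associated with $(G,\partial V)$ (all defined in the context). Define the Cheeger constant $$ h_R := \min_{\emptyset\neq S\subsetneq V} \frac{m(S,V\setminus S)}{\min\{\operatorname{vol}(S),\operatorname{vol}(V\setminus S)\}}. $$ Then $$ \sqrt{2\lambda_R}\;\ge\; h_R\;\ge\;\frac{\lambda_R}{2}. $$
   Context: Let $G=(V,E)$ be a graph, $\partial V\subseteq V$ a designated set of boundary vertices, and $\mathring V:=V\setminus\partial V$. Order the vertices so that those of $\mathring V$ come first, and write the adjacency matrix of $G$ in block form $$ A=\begin{pmatrix}A_{11}&A_{12}\\ A_{12}^\top&A_{22}\end{pmatrix}, $$ where $A_{11}=A(\mathring V,\mathring V)$, $A_{12}=A(\mathring V,\partial V)$, $A_{22}=A(\partial V,\partial V)$ are the submatrices with rows and columns indexed by the indicated sets. The reflected adjacency matrix is $$ R:=\begin{pmatrix}A_{11}&A_{12}\\ 2A_{12}^\top&A_{22}\end{pmatrix}. $$ Let $\vec 1$ be the all-ones vector and $D:=\operatorname{diag}(R\vec 1)$, the diagonal matrix of row sums of $R$. The reflected Neumann Laplacian is $L_R:=D-R$, and the normalized reflected Neumann graph Laplacian is $\mathcal{L}_R:=D^{-1/2}L_RD^{-1/2}$. Let $Q$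 be the diagonal matrix with entry $1$ at each vertex of $\mathring V$ and entry $\tfrac12$ at each vertex of $\partial V$. The matrix $Q^{1/2}\mathcal{L}_RQ^{-1/2}$ is symmetric and positive semidefinite, and has $D^{1/2}Q^{1/2}\vec 1$ as an eigenvector with eigenvalue $0$. The first nontrivial eigenvalue of $\mathcal{L}_R$ is $$ \lambda_R:=\inf_{x\in\mathbb{R}^V\setminus\{0\},\; x^\top D^{1/2}Q^{1/2}\vec 1=0}\frac{x^\top Q^{1/2}\mathcal{L}_RQ^{-1/2}x}{x^\top x}. $$ For $U,W\subseteq V$ let $E(U,W):=\{\{u,w\}\in E: u\in U,\ w\in W\}$, and define $$ m(U,W):=|E(U,W)|-\tfrac12\,|E(U\cap\partial V,\,W\cap\partial V)|,\qquad \operatorname{vol}(U):=\sum_{u\in U}m(\{u\},V). $$ *)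

theory Defs
  imports "HOL-Analysis.Analysis"
begin

text \<open>A finite simple graph on the vertex set \<open>UNIV :: 'v set\<close>, for a finite type \<open>'v\<close>, is
  given by its set \<open>E\<close> of edges, which are two-element sets of vertices. The set of
  boundary vertices is \<open>B\<close>. Matrices are indexed by \<open>'v\<close> itself, so block form is expressed
  by membership of the row and column index in \<open>B\<close>.\<close>

definition simple_graph :: "'v set set \<Rightarrow> bool" where
  "simple_graph E \<longleftrightarrow> (\<forall>e\<in>E. card e = 2)"

definition no_isolated :: "'v set set \<Rightarrow> bool" where
  "no_isolated E \<longleftrightarrow> (\<forall>v. \<exists>w. {v, w} \<in> E)"

definition adj_matrix :: "'v::finite set set \<Rightarrow> real^'v^'v" where
  "adj_matrix E = (\<chi> u w. if {u, w} \<in> E then 1 else 0)"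

definition reflected_adj :: "'v::finite set set \<Rightarrow> 'v set \<Rightarrow> real^'v^'v" where
  "reflected_adj E B =
     (\<chi> u w. if u \<in> B \<and> w \<notin> B then 2 * adj_matrix E $ u $ w else adj_matrix E $ u $ w)"

definition diag_matrix :: "real^'v::finite \<Rightarrow> real^'v^'v" where
  "diag_matrix d = (\<chi> u w. if u = w then d $ u else 0)"

text \<open>Real power of a diagonal matrix with positive diagonal entries; off-diagonal entries of
  the argument are ignored.\<close>

definition diag_powr :: "real^'v^'v::finite \<Rightarrow> real \<Rightarrow> real^'v^'v" where
  "diag_powr M a = diag_matrix (\<chi> u. (M $ u $ u) powr a)"

definition degree_matrix :: "'v::finite set set \<Rightarrow> 'v set \<Rightarrow> real^'v^'v" where
  "degree_matrix E B = diag_matrix (reflected_adj E B *v vec 1)"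

definition reflected_laplacian :: "'v::finite set set \<Rightarrow> 'v set \<Rightarrow> real^'v^'v" where
  "reflected_laplacian E B = degree_matrix E B - reflected_adj E B"

definition normalized_laplacian :: "'v::finite set set \<Rightarrow> 'v set \<Rightarrow> real^'v^'v" where
  "normalized_laplacian E B =
     diag_powr (degree_matrix E B) (- 1/2) ** reflected_laplacian E B
       ** diag_powr (degree_matrix E B) (- 1/2)"

definition Q_matrix :: "'v::finite set \<Rightarrow> real^'v^'v" where
  "Q_matrix B = diag_matrix (\<chi> u. if u \<in> B then 1/2 else 1)"

definition symmetrized_laplacian :: "'v::finite set set \<Rightarrow> 'v set \<Rightarrow> real^'v^'v" where
  "symmetrized_laplacian E B =
     diag_powr (Q_matrix B) (1/2) ** normalized_laplacian E B ** diag_powr (Q_matrix B) (- 1/2)"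

definition ground_vector :: "'v::finite set set \<Rightarrow> 'v set \<Rightarrow> real^'v" where
  "ground_vector E B =
     (diag_powr (degree_matrix E B) (1/2) ** diag_powr (Q_matrix B) (1/2)) *v vec 1"

definition lambda_R :: "'v::finite set set \<Rightarrow> 'v set \<Rightarrow> real" where
  "lambda_R E B =
     (INF x \<in> {x. x \<noteq> 0 \<and> x \<bullet> ground_vector E B = 0}.
        (x \<bullet> (symmetrized_laplacian E B *v x)) / (x \<bullet> x))"

definition edges_between :: "'v set set \<Rightarrow> 'v set \<Rightarrow> 'v set \<Rightarrow> 'v set set" where
  "edges_between E U W = {{u, w} | u w. {u, w} \<in> E \<and> u \<in> U \<and> w \<in> W}"

definition edge_measure :: "'v::finite set set \<Rightarrow> 'v set \<Rightarrow> 'v set \<Rightarrow> 'v set \<Rightarrow> real" where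
  "edge_measure E B U W =
     real (card (edges_between E U W)) - 1/2 * real (card (edges_between E (U \<inter> B) (W \<inter> B)))"

definition vol :: "'v::finite set set \<Rightarrow> 'v set \<Rightarrow> 'v set \<Rightarrow> real" where
  "vol E B U = (\<Sum>u\<in>U. edge_measure E B {u} UNIV)"

definition cheeger_R :: "'v::finite set set \<Rightarrow> 'v set \<Rightarrow> real" where
  "cheeger_R E B =
     Min ((\<lambda>S. edge_measure E B S (- S) / min (vol E B S) (vol E B (- S)))
            ` {S. S \<noteq> {} \<and> S \<noteq> UNIV})"

end

theory Submission imports Defs begin

text \<open>Multiplying row \<open>u\<close> of the reflected adjacency matrix by \<open>Q u u\<close> gives a symmetric weight
  \<open>w\<close>, which is the adjacency matrix with every edge inside the boundary weighted by \<open>1/2\<close>. The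
  substitution \<open>x = D\<^sup>1\<^sup>/\<^sup>2 Q\<^sup>1\<^sup>/\<^sup>2 f\<close> turns the Rayleigh quotient into that of the Laplacian of the
  weighted graph \<open>w\<close>, and \<open>m\<close> and \<open>vol\<close> are its cut and volume. So the claim is the Cheeger
  inequality for weighted graphs. For the lower bound on \<open>h\<close> one tests with a centred indicator
  function. For the upper bound one splits \<open>f\<close>, shifted by a weighted median, into positive and
  negative parts and compares each with the cuts along its level sets.\<close>

section \<open>Weighted graphs: degree, volume, cut and energy\<close>

locale weighted_graph =
  fixes w :: "'v::finite \<Rightarrow> 'v \<Rightarrow> real"
  assumes w_sym: "w u v = w v u"
    and w_nonneg: "0 \<le> w u v"
    and w_row_pos: "0 < (\<Sum>v\<in>UNIV. w u v)"
begin

definition deg :: "'v \<Rightarrow> real" where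
  "deg u = (\<Sum>v\<in>UNIV. w u v)"

definition volume :: "'v set \<Rightarrow> real" where
  "volume S = sum deg S"

definition cut :: "'v set \<Rightarrow> real" where
  "cut S = (\<Sum>u\<in>S. \<Sum>v\<in>-S. w u v)"

text \<open>The sum runs over ordered pairs, so every edge is counted twice.\<close>

definition energy :: "('v \<Rightarrow> real) \<Rightarrow> real" where
  "energy f = (\<Sum>u\<in>UNIV. \<Sum>v\<in>UNIV. w u v * (f u - f v)\<^sup>2)"

lemma deg_pos: "0 < deg u"
  using w_row_pos by (simp add: deg_def)

lemma deg_nonneg: "0 \<le> deg u"
  using deg_pos[of u] by simp

lemma volume_pos: "S \<noteq> {} \<Longrightarrow> 0 < volume S"
  unfolding volume_def by (rule sum_pos) (auto simp: deg_pos)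

lemma volume_nonneg: "0 \<le> volume S"
  unfolding volume_def by (rule sum_nonneg) (rule deg_nonneg)

lemma volume_mono: "S \<subseteq> T \<Longrightarrow> volume S \<le> volume T"
  unfolding volume_def by (rule sum_mono2) (auto simp: deg_nonneg)

lemma volume_Compl: "volume (- S) = volume UNIV - volume S"
  unfolding volume_def Compl_eq_Diff_UNIV by (rule sum_diff) auto

lemma cut_nonneg: "0 \<le> cut S"
  unfolding cut_def by (intro sum_nonneg w_nonneg)

lemma energy_nonneg: "0 \<le> energy f"
  unfolding energy_def by (intro sum_nonneg mult_nonneg_nonneg w_nonneg) auto

lemma sum_w_fst: "(\<Sum>u\<in>UNIV. \<Sum>v\<in>UNIV. w u v * g u) = (\<Sum>u\<in>UNIV. deg u * g u)"
  by (simp add: deg_def sum_distrib_right)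

lemma sum_w_snd: "(\<Sum>u\<in>UNIV. \<Sum>v\<in>UNIV. w u v * g v) = (\<Sum>u\<in>UNIV. deg u * g u)"
proof -
  have "(\<Sum>u\<in>UNIV. \<Sum>v\<in>UNIV. w u v * g v) = (\<Sum>v\<in>UNIV. \<Sum>u\<in>UNIV. w v u * g v)"
    by (subst sum.swap) (simp add: w_sym)
  then show ?thesis by (simp add: sum_w_fst)
qed

text \<open>Expanding the square and using the symmetry of \<open>w\<close> turns both square terms
  into degree sums. The bracket is the quadratic form of the Laplacian with diagonal
  \<open>deg\<close> and weights \<open>w\<close>.\<close>

lemma energy_expand:
  "energy f = 2 * ((\<Sum>u\<in>UNIV. deg u * (f u)\<^sup>2) - (\<Sum>u\<in>UNIV. \<Sum>v\<in>UNIV. w u v * (f u * f v)))"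
proof -
  have "energy f = (\<Sum>u\<in>UNIV. \<Sum>v\<in>UNIV. w u v * (f u)\<^sup>2) + (\<Sum>u\<in>UNIV. \<Sum>v\<in>UNIV. w u v * (f v)\<^sup>2)
      - 2 * (\<Sum>u\<in>UNIV. \<Sum>v\<in>UNIV. w u v * (f u * f v))"
    unfolding energy_def sum_distrib_left sum.distrib[symmetric] sum_subtractf[symmetric]
    by (intro sum.cong refl) (simp add: power2_eq_square algebra_simps)
  then show ?thesis
    using sum_w_fst[of "\<lambda>u. (f u)\<^sup>2"] sum_w_snd[of "\<lambda>u. (f u)\<^sup>2"] by simp
qed

section \<open>Level sets: from cuts to a lower bound on the energy\<close>

text \<open>Each crossing pair appears in both orders, hence the factor 2.\<close>

lemma sum_w_crossing:
  "(\<Sum>u\<in>UNIV. \<Sum>v\<in>UNIV. w u v * of_bool ((u \<in> S) \<noteq> (v \<in> S))) = 2 * cut S"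
proof -
  have 1: "(\<Sum>u\<in>UNIV. \<Sum>v\<in>UNIV. w u v * of_bool (u \<in> S \<and> v \<notin> S)) = cut S"
  proof -
    have "(\<Sum>v\<in>UNIV. w u v * of_bool (u \<in> S \<and> v \<notin> S)) = (if u \<in> S then \<Sum>v\<in>-S. w u v else 0)" for u
      by (auto intro!: sum.mono_neutral_cong_right)
    then show ?thesis
      by (simp add: cut_def sum.If_cases)
  qed
  have 2: "(\<Sum>u\<in>UNIV. \<Sum>v\<in>UNIV. w u v * of_bool (u \<notin> S \<and> v \<in> S)) = cut S"
    unfolding 1[symmetric] by (subst sum.swap) (simp add: w_sym conj_commute)
  have "(\<Sum>u\<in>UNIV. \<Sum>v\<in>UNIV. w u v * of_bool ((u \<in> S) \<noteq> (v \<in> S)))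
    = (\<Sum>u\<in>UNIV. \<Sum>v\<in>UNIV. w u v * of_bool (u \<in> S \<and> v \<notin> S))
     + (\<Sum>u\<in>UNIV. \<Sum>v\<in>UNIV. w u v * of_bool (u \<notin> S \<and> v \<in> S))"
    unfolding sum.distrib[symmetric] by (intro sum.cong refl) auto
  then show ?thesis using 1 2 by simp
qed

text \<open>A discrete co-area inequality: subtracting the least positive value of \<open>r\<close> on its support
  peels off one level set.\<close>

lemma level_set_bound:
  fixes r :: "'v \<Rightarrow> real"
  assumes "\<And>u. 0 \<le> r u"
    and iso: "\<And>S. S \<noteq> {} \<Longrightarrow> S \<subseteq> {u. 0 < r u} \<Longrightarrow> h * volume S \<le> cut S"
  shows "2 * h * (\<Sum>u\<in>UNIV. deg u * r u) \<le> (\<Sum>u\<in>UNIV. \<Sum>v\<in>UNIV. w u v * \<bar>r u - r v\<bar>)"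
  using assms
proof (induction "card {u. 0 < r u}" arbitrary: r rule: less_induct)
  case less
  define S where "S = {u. 0 < r u}"
  show ?case
  proof (cases "S = {}")
    case True
    then have "r u = 0" for u
      using less.prems(1)[of u] by (auto simp: S_def not_less intro: antisym)
    then show ?thesis by simp
  next
    case False
    define a where "a = Min (r ` S)"
    have "a \<in> r ` S" unfolding a_def using False by (intro Min_in) auto
    then obtain s where s: "s \<in> S" "a = r s" by auto
    then have "0 < a" by (simp add: S_def)
    have a_le: "a \<le> r u" if "u \<in> S" for u
      unfolding a_def using that by (intro Min_le) auto
    have r0: "r u = 0" if "u \<notin> S" for u
      using less.prems(1)[of u] that by (simp add: S_def)
    define r' where "r' u = r u - a * of_bool (u \<in> S)" for u
    have r'_nonneg: "0 \<le> r' u" for u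
      using a_le[of u] r0[of u] by (auto simp: r'_def)
    have sub: "{u. 0 < r' u} \<subseteq> S"
      using r0 by (auto simp: r'_def intro: ccontr)
    \<comment> \<open>The minimum is attained at \<open>s\<close>, so \<open>s\<close> leaves the
      support and the induction measure drops.\<close>
    moreover have "s \<notin> {u. 0 < r' u}" using s by (simp add: r'_def)
    ultimately have "{u. 0 < r' u} \<subset> {u. 0 < r u}" using s(1) unfolding S_def by blast
    then have "card {u. 0 < r' u} < card {u. 0 < r u}"
      by (intro psubset_card_mono) auto
    then have IH: "2 * h * (\<Sum>u\<in>UNIV. deg u * r' u) \<le> (\<Sum>u\<in>UNIV. \<Sum>v\<in>UNIV. w u v * \<bar>r' u - r' v\<bar>)"
      using less.hyps r'_nonneg less.prems(2) sub unfolding S_def by (meson order_trans)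
    \<comment> \<open>Differences within \<open>S\<close> and within its complement do not change.
      Across the boundary of \<open>S\<close> one value is 0 and the other drops by \<open>a\<close>
      without becoming negative, so exactly \<open>a\<close> is lost.\<close>
    have "\<bar>r u - r v\<bar> = \<bar>r' u - r' v\<bar> + a * of_bool ((u \<in> S) \<noteq> (v \<in> S))" for u v
      using a_le[of u] a_le[of v] r0[of u] r0[of v] \<open>0 < a\<close> by (auto simp: r'_def)
    then have "(\<Sum>u\<in>UNIV. \<Sum>v\<in>UNIV. w u v * \<bar>r u - r v\<bar>)
        = (\<Sum>u\<in>UNIV. \<Sum>v\<in>UNIV. w u v * \<bar>r' u - r' v\<bar>) + a * (2 * cut S)"
      unfolding sum_w_crossing[symmetric] sum_distrib_left sum.distrib[symmetric]
      by (intro sum.cong refl) (simp only: distrib_left mult.left_commute)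
    moreover have "(\<Sum>u\<in>UNIV. deg u * r u) = (\<Sum>u\<in>UNIV. deg u * r' u) + a * volume S"
    proof -
      have "volume S = (\<Sum>u\<in>UNIV. deg u * of_bool (u \<in> S))"
        unfolding volume_def by (auto intro!: sum.mono_neutral_cong_left)
      show ?thesis
        unfolding \<open>volume S = _\<close> sum_distrib_left sum.distrib[symmetric]
        by (intro sum.cong refl) (simp add: r'_def algebra_simps)
    qed
    moreover have "a * (h * volume S) \<le> a * cut S"
      using less.prems(2)[of S] False \<open>0 < a\<close> by (intro mult_left_mono) (auto simp: S_def)
    ultimately show ?thesis using IH by (simp add: algebra_simps)
  qed
qed

text \<open>Apply the co-area inequality to \<open>p^2\<close>, which has the same support as
  \<open>p\<close>, and multiply by one more \<open>h\<close>. With \<open>?P\<close> the weighted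
  sum of squares this bounds \<open>2 * h^2 * ?P\<close> by a sum that AM-GM bounds by
  \<open>energy p + h^2 * ?P\<close>; then \<open>h^2 * ?P\<close> cancels. This replaces the usual
  Cauchy-Schwarz step.\<close>

lemma energy_lower_bound:
  fixes p :: "'v \<Rightarrow> real"
  assumes p: "\<And>u. 0 \<le> p u" and h: "0 \<le> h"
    and iso: "\<And>S. S \<noteq> {} \<Longrightarrow> S \<subseteq> {u. 0 < p u} \<Longrightarrow> h * volume S \<le> cut S"
  shows "h\<^sup>2 * (\<Sum>u\<in>UNIV. deg u * (p u)\<^sup>2) \<le> energy p"
proof -
  let ?P = "\<Sum>u\<in>UNIV. deg u * (p u)\<^sup>2"
  have "2 * h * ?P \<le> (\<Sum>u\<in>UNIV. \<Sum>v\<in>UNIV. w u v * \<bar>(p u)\<^sup>2 - (p v)\<^sup>2\<bar>)"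
    by (rule level_set_bound) (use p iso in \<open>auto simp: order_less_le\<close>)
  then have "h * (2 * h * ?P) \<le> h * (\<Sum>u\<in>UNIV. \<Sum>v\<in>UNIV. w u v * \<bar>(p u)\<^sup>2 - (p v)\<^sup>2\<bar>)"
    using h by (rule mult_left_mono)
  also have "\<dots> = (\<Sum>u\<in>UNIV. \<Sum>v\<in>UNIV. w u v * (h * \<bar>(p u)\<^sup>2 - (p v)\<^sup>2\<bar>))"
    by (simp add: sum_distrib_left mult.left_commute)
  also have "\<dots> \<le> (\<Sum>u\<in>UNIV. \<Sum>v\<in>UNIV. w u v * ((p u - p v)\<^sup>2 + h\<^sup>2 / 2 * (p u)\<^sup>2 + h\<^sup>2 / 2 * (p v)\<^sup>2))"
  proof (intro sum_mono mult_left_mono w_nonneg)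
    fix u v
    text \<open>AM-GM for \<open>\<bar>p u - p v\<bar>\<close> and \<open>h (p u + p v) / 2\<close>\<close>
    have "h * \<bar>(p u)\<^sup>2 - (p v)\<^sup>2\<bar> = 2 * \<bar>p u - p v\<bar> * (h * (p u + p v) / 2)"
      using p[of u] p[of v] by (simp add: power2_eq_square square_diff_square_factored abs_mult)
    also have "\<dots> \<le> \<bar>p u - p v\<bar>\<^sup>2 + (h * (p u + p v) / 2)\<^sup>2"
      by (rule sum_squares_bound)
    also have "\<dots> = (p u - p v)\<^sup>2 + h\<^sup>2 / 4 * (p u + p v)\<^sup>2"
      by (simp add: power_mult_distrib power_divide)
    also have "\<dots> \<le> (p u - p v)\<^sup>2 + h\<^sup>2 / 4 * (2 * (p u)\<^sup>2 + 2 * (p v)\<^sup>2)"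
      using sum_squares_bound[of "p u" "p v"]
      by (intro add_left_mono mult_left_mono) (auto simp: power2_sum)
    finally show "h * \<bar>(p u)\<^sup>2 - (p v)\<^sup>2\<bar> \<le> (p u - p v)\<^sup>2 + h\<^sup>2 / 2 * (p u)\<^sup>2 + h\<^sup>2 / 2 * (p v)\<^sup>2"
      by (simp add: algebra_simps)
  qed
  also have "\<dots> = energy p + h\<^sup>2 / 2 * ?P + h\<^sup>2 / 2 * ?P"
    using sum_w_fst[of "\<lambda>u. h\<^sup>2 / 2 * (p u)\<^sup>2"] sum_w_snd[of "\<lambda>u. h\<^sup>2 / 2 * (p u)\<^sup>2"]
    unfolding energy_def sum_distrib_left distrib_left sum.distrib
    by (simp only: mult.left_commute)
  finally show ?thesis by (simp add: power2_eq_square)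
qed

section \<open>Weighted median and the upper Cheeger bound\<close>

text \<open>Take for \<open>c\<close> the least value of \<open>f\<close> whose strict superlevel
  set has at most half the volume. If \<open>c'\<close> is the next smaller value, minimality gives
  \<open>{u. c' < f u}\<close> more than half, and its complement is
  \<open>{u. f u < c}\<close>.\<close>

lemma weighted_median:
  fixes f :: "'v \<Rightarrow> real"
  obtains c where "volume {u. c < f u} \<le> volume UNIV / 2" "volume {u. f u < c} \<le> volume UNIV / 2"
proof -
  define C where "C = {c \<in> range f. volume {u. c < f u} \<le> volume UNIV / 2}"
  have "{u. Max (range f) < f u} = {}"
    using Max_ge[of "range f"] by (auto simp: not_less simp del: Max_less_iff)
  then have "volume {u. Max (range f) < f u} \<le> volume UNIV / 2"
    using volume_nonneg[of UNIV] by (simp only: volume_def sum.empty)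
  moreover have "Max (range f) \<in> range f" by (intro Max_in) auto
  ultimately have "Max (range f) \<in> C" unfolding C_def by blast
  moreover have "finite C" by (simp add: C_def)
  ultimately have "Min C \<in> C" by (intro Min_in) blast+
  define c where "c = Min C"
  have "volume {u. f u < c} \<le> volume UNIV / 2"
  proof (cases "{u. f u < c} = {}")
    case True
    then show ?thesis using volume_nonneg[of UNIV] by (simp add: volume_def)
  next
    case False
    define c' where "c' = Max (f ` {u. f u < c})"
    have "c' \<in> f ` {u. f u < c}" unfolding c'_def using False by (intro Max_in) auto
    then have c': "c' \<in> range f" "c' < c" by auto
    have "f u \<le> c'" if "f u < c" for u
      unfolding c'_def using that by (intro Max_ge) auto
    then have "{u. c' < f u} = - {u. f u < c}"
      using c'(2) by (force simp: not_le)
    moreover have "c' \<notin> C"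
      using c'(2) Min_le[OF \<open>finite C\<close>, of c'] by (auto simp: c_def)
    ultimately have "volume UNIV / 2 < volume (- {u. f u < c})"
      using c'(1) by (auto simp: C_def)
    then show ?thesis by (simp add: volume_Compl)
  qed
  with \<open>Min C \<in> C\<close> show thesis by (intro that[of c]) (auto simp: C_def c_def)
qed

text \<open>By the choice of the median, the supports of the positive and negative parts of
  \<open>f - c\<close> have at most half the volume. For subsets of these the minimum in
  \<open>iso\<close> is the volume of the subset itself, so \<open>energy_lower_bound\<close>
  applies to each part.\<close>

lemma cheeger_upper:
  fixes f :: "'v \<Rightarrow> real"
  assumes h: "0 \<le> h"
    and iso: "\<And>S. S \<noteq> {} \<Longrightarrow> S \<noteq> UNIV \<Longrightarrow> h * min (volume S) (volume (- S)) \<le> cut S"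
    and centred: "(\<Sum>u\<in>UNIV. deg u * f u) = 0"
  shows "h\<^sup>2 * (\<Sum>u\<in>UNIV. deg u * (f u)\<^sup>2) \<le> energy f"
proof -
  obtain c where c: "volume {u. c < f u} \<le> volume UNIV / 2" "volume {u. f u < c} \<le> volume UNIV / 2"
    by (rule weighted_median)
  have iso_small: "h * volume S \<le> cut S" if "S \<noteq> {}" "volume S \<le> volume UNIV / 2" for S
  proof -
    have "S \<noteq> UNIV" using that volume_pos[of UNIV] by auto
    moreover have "min (volume S) (volume (- S)) = volume S"
      using that by (simp add: volume_Compl)
    ultimately show ?thesis using iso[of S] that by simp
  qed
  define p where "p u = max (f u - c) 0" for u
  define n where "n u = max (c - f u) 0" for u
  have p: "h\<^sup>2 * (\<Sum>u\<in>UNIV. deg u * (p u)\<^sup>2) \<le> energy p"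
  proof (rule energy_lower_bound)
    fix S assume "S \<noteq> {}" "S \<subseteq> {u. 0 < p u}"
    then show "h * volume S \<le> cut S"
      using c(1) volume_mono[of S "{u. c < f u}"] by (intro iso_small) (force simp: p_def)+
  qed (auto simp: p_def h)
  have n: "h\<^sup>2 * (\<Sum>u\<in>UNIV. deg u * (n u)\<^sup>2) \<le> energy n"
  proof (rule energy_lower_bound)
    fix S assume "S \<noteq> {}" "S \<subseteq> {u. 0 < n u}"
    then show "h * volume S \<le> cut S"
      using c(2) volume_mono[of S "{u. f u < c}"] by (intro iso_small) (force simp: n_def)+
  qed (auto simp: n_def h)
  \<comment> \<open>The mean of \<open>f\<close> is 0, so the cross term vanishes and shifting by
    \<open>c\<close> can only increase the weighted sum of squares. The shifted sum splits because
    \<open>p\<close> and \<open>n\<close> have disjoint supports.\<close>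
  have "(\<Sum>u\<in>UNIV. deg u * (f u)\<^sup>2)
      \<le> (\<Sum>u\<in>UNIV. deg u * (f u)\<^sup>2) - 2 * c * (\<Sum>u\<in>UNIV. deg u * f u) + (\<Sum>u\<in>UNIV. deg u * c\<^sup>2)"
    unfolding centred by (simp add: sum_nonneg deg_nonneg)
  also have "\<dots> = (\<Sum>u\<in>UNIV. deg u * (p u)\<^sup>2) + (\<Sum>u\<in>UNIV. deg u * (n u)\<^sup>2)"
    unfolding sum_distrib_left sum.distrib[symmetric] sum_subtractf[symmetric]
    by (intro sum.cong refl) (auto simp: p_def n_def max_def power2_eq_square algebra_simps)
  finally have "h\<^sup>2 * (\<Sum>u\<in>UNIV. deg u * (f u)\<^sup>2)
      \<le> h\<^sup>2 * ((\<Sum>u\<in>UNIV. deg u * (p u)\<^sup>2) + (\<Sum>u\<in>UNIV. deg u * (n u)\<^sup>2))"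
    by (intro mult_left_mono) auto
  also have "\<dots> \<le> energy p + energy n"
    using p n by (simp add: distrib_left)
  also have "\<dots> \<le> energy f"
    unfolding energy_def sum.distrib[symmetric] distrib_left[symmetric]
  proof (intro sum_mono mult_left_mono w_nonneg)
    fix u v
    text \<open>The difference of the two sides is \<open>2 (p u * n v + p v * n u)\<close>.\<close>
    have diff: "f u - f v = (p u - p v) - (n u - n v)"
      by (auto simp: p_def n_def max_def)
    have sq: "(f u - f v)\<^sup>2 = (p u - p v)\<^sup>2 + (n u - n v)\<^sup>2 + 2 * (p u * n v + p v * n u)
        - 2 * (p u * n u) - 2 * (p v * n v)"
      unfolding diff by (simp add: power2_eq_square algebra_simps)
    have disjoint: "p u * n u = 0" for u
      by (simp add: p_def n_def max_def)
    have "0 \<le> p u * n v" "0 \<le> p v * n u"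
      by (simp_all add: p_def n_def)
    then show "(p u - p v)\<^sup>2 + (n u - n v)\<^sup>2 \<le> (f u - f v)\<^sup>2"
      unfolding sq disjoint by simp
  qed
  finally show ?thesis .
qed

section \<open>The test function for the lower Cheeger bound\<close>

lemma cheeger_lower:
  assumes S: "S \<noteq> {}" "S \<noteq> UNIV"
  obtains f where "(\<Sum>u\<in>UNIV. deg u * f u) = 0" "0 < (\<Sum>u\<in>UNIV. deg u * (f u)\<^sup>2)"
    "energy f * min (volume S) (volume (- S)) \<le> 4 * cut S * (\<Sum>u\<in>UNIV. deg u * (f u)\<^sup>2)"
proof -
  define a b where "a = volume S" and "b = volume (- S)"
  have pos: "0 < a" "0 < b" unfolding a_def b_def using S by (auto intro!: volume_pos)
  \<comment> \<open>This is the indicator of \<open>S\<close> minus its \<open>deg\<close>-weighted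
    mean, scaled by the total volume \<open>a + b\<close> to avoid fractions.\<close>
  define f where "f u = (if u \<in> S then b else - a)" for u
  \<comment> \<open>Used with the square for the norm and with the identity for centring, where the
    two terms cancel.\<close>
  have split: "(\<Sum>u\<in>UNIV. deg u * g (f u)) = a * g b + b * g (- a)" for g
  proof -
    have "(\<Sum>u\<in>UNIV. deg u * g (f u)) = (\<Sum>u\<in>S. deg u * g (f u)) + (\<Sum>u\<in>-S. deg u * g (f u))"
      using sum.Int_Diff[of UNIV "\<lambda>u. deg u * g (f u)" S] by (simp add: Compl_eq_Diff_UNIV)
    then show ?thesis by (simp add: f_def a_def b_def volume_def sum_distrib_right)
  qed
  have sq: "(\<Sum>u\<in>UNIV. deg u * (f u)\<^sup>2) = a * b * (a + b)"
    unfolding split[of "\<lambda>t. t\<^sup>2"] by (simp add: power2_eq_square algebra_simps)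
  have "energy f = (\<Sum>u\<in>UNIV. \<Sum>v\<in>UNIV. w u v * of_bool ((u \<in> S) \<noteq> (v \<in> S))) * (a + b)\<^sup>2"
    unfolding energy_def sum_distrib_right
    by (intro sum.cong refl) (auto simp: f_def power2_eq_square algebra_simps)
  then have energy: "energy f = 2 * cut S * (a + b)\<^sup>2"
    by (simp only: sum_w_crossing)
  \<comment> \<open>The sum \<open>a + b\<close> is at most twice the larger of the two, and the
    larger times the smaller is \<open>a * b\<close>. This 2 and the double counting in
    \<open>energy\<close> make up the constant 4.\<close>
  have "(a + b) * min a b \<le> 2 * (a * b)"
    using pos by (auto simp: min_def distrib_right not_le mult.commute)
  then have "(2 * cut S * (a + b)) * ((a + b) * min a b) \<le> (2 * cut S * (a + b)) * (2 * (a * b))"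
    using pos cut_nonneg by (intro mult_left_mono) auto
  then have "energy f * min a b \<le> 4 * cut S * (a * b * (a + b))"
    unfolding energy by (simp add: power2_eq_square algebra_simps)
  moreover have "0 < a * b * (a + b)" using pos by simp
  ultimately show thesis
    using that[of f] split[of "\<lambda>t. t"] unfolding sq a_def[symmetric] b_def[symmetric] by simp
qed

end

section \<open>Edge counts of a graph with boundary as sums of weights\<close>

definition edge_weight :: "'v set set \<Rightarrow> 'v set \<Rightarrow> 'v \<Rightarrow> 'v \<Rightarrow> real" where
  "edge_weight E B u v = (if {u, v} \<in> E then if u \<in> B \<and> v \<in> B then 1/2 else 1 else 0)"

lemma diag_matrix_mult_nth: "(diag_matrix a ** M) $ u $ v = a $ u * M $ u $ v"
  by (simp add: matrix_matrix_mult_def diag_matrix_def mult_delta_left)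

lemma mult_diag_matrix_nth: "(M ** diag_matrix a) $ u $ v = M $ u $ v * a $ v"
  by (simp add: matrix_matrix_mult_def diag_matrix_def mult_delta_right)

lemma diag_matrix_mult_vec_nth: "(diag_matrix a *v x) $ u = a $ u * x $ u"
  by (simp add: matrix_vector_mult_def diag_matrix_def mult_delta_left)

text \<open>Edges are unordered while the sum runs over ordered pairs; injectivity says that no edge
  arises from two pairs. It holds for complementary sets (cuts) and for a singleton \<open>U\<close>
  (degrees).\<close>

lemma card_edges_between:
  fixes E :: "'v::finite set set"
  assumes "inj_on (\<lambda>(u, w). {u, w}) (U \<times> W)"
  shows "real (card (edges_between E U W)) = (\<Sum>u\<in>U. \<Sum>v\<in>W. of_bool ({u, v} \<in> E))"
proof -
  let ?P = "{(u, w) \<in> U \<times> W. {u, w} \<in> E}"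
  have "edges_between E U W = (\<lambda>(u, w). {u, w}) ` ?P"
    by (auto simp: edges_between_def)
  moreover have "inj_on (\<lambda>(u, w). {u, w}) ?P"
    using assms by (rule inj_on_subset) auto
  ultimately have "real (card (edges_between E U W)) = real (card ?P)"
    by (simp add: card_image)
  also have "\<dots> = (\<Sum>p\<in>?P. 1)" by simp
  also have "\<dots> = (\<Sum>p\<in>U \<times> W. of_bool ({fst p, snd p} \<in> E))"
    by (rule sum.mono_neutral_cong_left) auto
  finally show ?thesis by (simp only: sum.cartesian_product case_prod_unfold)
qed

lemma edge_measure_eq_sum:
  fixes E :: "'v::finite set set"
  assumes "inj_on (\<lambda>(u, w). {u, w}) (U \<times> W)"
  shows "edge_measure E B U W = (\<Sum>u\<in>U. \<Sum>v\<in>W. edge_weight E B u v)"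
proof -
  have "inj_on (\<lambda>(u, w). {u, w}) ((U \<inter> B) \<times> (W \<inter> B))"
    using assms by (rule inj_on_subset) auto
  then have "real (card (edges_between E (U \<inter> B) (W \<inter> B)))
      = (\<Sum>u\<in>U \<inter> B. \<Sum>v\<in>W \<inter> B. of_bool ({u, v} \<in> E))"
    by (rule card_edges_between)
  also have "\<dots> = (\<Sum>u\<in>U. \<Sum>v\<in>W. of_bool ({u, v} \<in> E \<and> u \<in> B \<and> v \<in> B))"
  proof (rule sum.mono_neutral_cong_left)
    show "(\<Sum>v\<in>W \<inter> B. of_bool ({u, v} \<in> E))
        = (\<Sum>v\<in>W. of_bool ({u, v} \<in> E \<and> u \<in> B \<and> v \<in> B) :: real)" if "u \<in> U \<inter> B" for u
      by (rule sum.mono_neutral_cong_left) (use that in auto)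
  qed auto
  finally have "edge_measure E B U W = (\<Sum>u\<in>U. \<Sum>v\<in>W. of_bool ({u, v} \<in> E))
      - 1/2 * (\<Sum>u\<in>U. \<Sum>v\<in>W. of_bool ({u, v} \<in> E \<and> u \<in> B \<and> v \<in> B))"
    using assms by (simp add: edge_measure_def card_edges_between)
  also have "\<dots> = (\<Sum>u\<in>U. \<Sum>v\<in>W. edge_weight E B u v)"
    unfolding sum_distrib_left sum_subtractf[symmetric]
    by (intro sum.cong refl) (auto simp: edge_weight_def)
  finally show ?thesis .
qed

lemma edge_measure_Compl:
  "edge_measure E B S (- S) = (\<Sum>u\<in>S. \<Sum>v\<in>-S. edge_weight E B u v)"
  by (rule edge_measure_eq_sum) (auto simp: inj_on_def doubleton_eq_iff)

lemma vol_eq_sum: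
  "vol E B S = (\<Sum>u\<in>S. \<Sum>v\<in>UNIV. edge_weight E B u v)"
proof -
  have "edge_measure E B {u} UNIV = (\<Sum>v\<in>UNIV. edge_weight E B u v)" for u
    by (subst edge_measure_eq_sum) (auto simp: inj_on_def doubleton_eq_iff)
  then show ?thesis by (simp add: vol_def)
qed

lemma weighted_graph_edge_weight:
  fixes E :: "'v::finite set set"
  assumes "no_isolated E"
  shows "weighted_graph (edge_weight E B)"
proof
  fix u v :: 'v
  show "edge_weight E B u v = edge_weight E B v u"
    by (auto simp: edge_weight_def insert_commute)
  show nonneg: "0 \<le> edge_weight E B u v" for u v
    by (simp add: edge_weight_def)
  obtain v where "{u, v} \<in> E"
    using assms by (auto simp: no_isolated_def)
  then have "0 < edge_weight E B u v" by (simp add: edge_weight_def)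
  then show "0 < (\<Sum>v\<in>UNIV. edge_weight E B u v)"
    by (rule sum_pos2[rotated 2]) (auto simp: nonneg)
qed

section \<open>The reflected Laplacian in terms of the weighted graph, and the two bounds\<close>

context
  fixes E :: "'v::finite set set" and B :: "'v set"
  assumes no_isolated: "no_isolated E"
begin

interpretation weighted_graph "edge_weight E B"
  using no_isolated by (rule weighted_graph_edge_weight)

text \<open>Multiplication by \<open>Q_matrix\<close> halves the boundary rows: the doubled entries
  towards the interior return to 1 and those inside the boundary become \<open>1/2\<close>. So each
  row sum becomes \<open>deg u\<close>.\<close>

lemma degree_matrix_nth:
  "degree_matrix E B $ u $ u = deg u / Q_matrix B $ u $ u"
proof -
  have "degree_matrix E B $ u $ u * Q_matrix B $ u $ u = deg u"
    unfolding deg_def degree_matrix_def diag_matrix_def matrix_vector_mult_def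
    by (auto simp: sum_distrib_right reflected_adj_def adj_matrix_def edge_weight_def
        Q_matrix_def diag_matrix_def intro!: sum.cong)
  then show ?thesis by (simp add: Q_matrix_def diag_matrix_def field_simps split: if_splits)
qed

lemma reflected_laplacian_nth:
  "Q_matrix B $ u $ u * reflected_laplacian E B $ u $ v = (if u = v then deg u else 0) - edge_weight E B u v"
proof -
  have "degree_matrix E B $ u $ v = (if u = v then deg u / Q_matrix B $ u $ u else 0)"
    using degree_matrix_nth[of u] by (auto simp: degree_matrix_def diag_matrix_def)
  then show ?thesis
    by (auto simp: reflected_laplacian_def reflected_adj_def adj_matrix_def edge_weight_def
        Q_matrix_def diag_matrix_def algebra_simps)
qed

lemma Q_matrix_pos: "0 < Q_matrix B $ u $ u"
  by (simp add: Q_matrix_def diag_matrix_def)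

lemma ground_vector_nth: "ground_vector E B $ u = sqrt (deg u)"
  using Q_matrix_pos[of u] deg_pos[of u]
  by (simp add: ground_vector_def diag_powr_def diag_matrix_mult_vec_nth degree_matrix_nth
      powr_half_sqrt real_sqrt_divide matrix_vector_mul_assoc[symmetric])

text \<open>Write \<open>q\<close> for the diagonal of \<open>Q_matrix B\<close>. Since the degree
  matrix has diagonal \<open>deg / q\<close>, the factors to the left of
  \<open>reflected_laplacian\<close> combine to \<open>q u / sqrt (deg u)\<close> and those to the
  right to \<open>1 / sqrt (deg v)\<close>. The square roots cancel and leave the row-scaled matrix
  of \<open>reflected_laplacian_nth\<close>.\<close>

lemma symmetrized_laplacian_nth:
  "sqrt (deg u) * symmetrized_laplacian E B $ u $ v * sqrt (deg v)
    = (if u = v then deg u else 0) - edge_weight E B u v"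
proof -
  have pos: "0 < Q_matrix B $ x $ x" "0 < deg x" for x
    by (rule Q_matrix_pos deg_pos)+
  have "sqrt (deg u) * symmetrized_laplacian E B $ u $ v * sqrt (deg v)
      = Q_matrix B $ u $ u * reflected_laplacian E B $ u $ v"
    using pos[of u] pos[of v] real_sqrt_mult_self[of "Q_matrix B $ u $ u"]
    by (simp add: symmetrized_laplacian_def normalized_laplacian_def diag_powr_def
        diag_matrix_mult_nth mult_diag_matrix_nth degree_matrix_nth powr_minus powr_half_sqrt
        real_sqrt_divide field_simps)
  then show ?thesis by (simp add: reflected_laplacian_nth)
qed

text \<open>Dictionary for the substitution: orthogonality to the ground vector becomes centring,
  and the half undoes the double counting in \<open>energy\<close>.\<close>

lemma
  fixes f :: "'v \<Rightarrow> real"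
  defines "x \<equiv> (\<chi> u. sqrt (deg u) * f u)"
  shows inner_self: "x \<bullet> x = (\<Sum>u\<in>UNIV. deg u * (f u)\<^sup>2)"
    and inner_ground: "x \<bullet> ground_vector E B = (\<Sum>u\<in>UNIV. deg u * f u)"
    and inner_laplacian: "x \<bullet> (symmetrized_laplacian E B *v x) = energy f / 2"
proof -
  have sqrt: "sqrt (deg u) * (sqrt (deg u) * a) = deg u * a" for u a
    using deg_nonneg[of u] by (simp add: mult.assoc[symmetric])
  show "x \<bullet> x = (\<Sum>u\<in>UNIV. deg u * (f u)\<^sup>2)"
    by (simp add: inner_vec_def x_def power2_eq_square mult_ac sqrt deg_nonneg)
  show "x \<bullet> ground_vector E B = (\<Sum>u\<in>UNIV. deg u * f u)"
    by (simp add: inner_vec_def x_def ground_vector_nth mult_ac sqrt deg_nonneg)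
  have "x \<bullet> (symmetrized_laplacian E B *v x)
      = (\<Sum>u\<in>UNIV. \<Sum>v\<in>UNIV. sqrt (deg u) * symmetrized_laplacian E B $ u $ v * sqrt (deg v) * (f u * f v))"
    by (simp add: inner_vec_def matrix_vector_mult_def x_def sum_distrib_left mult_ac)
  also have "\<dots> = (\<Sum>u\<in>UNIV. \<Sum>v\<in>UNIV. (if u = v then deg u * (f u)\<^sup>2 else 0))
      - (\<Sum>u\<in>UNIV. \<Sum>v\<in>UNIV. edge_weight E B u v * (f u * f v))"
    unfolding symmetrized_laplacian_nth sum_subtractf[symmetric]
    by (intro sum.cong refl) (auto simp: algebra_simps power2_eq_square)
  also have "\<dots> = energy f / 2"
    by (simp add: energy_expand)
  finally show "x \<bullet> (symmetrized_laplacian E B *v x) = energy f / 2" .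
qed

lemma edge_measure_eq_cut: "edge_measure E B S (- S) = cut S"
  by (simp add: edge_measure_Compl cut_def)

lemma vol_eq_volume: "vol E B S = volume S"
  by (simp add: vol_eq_sum volume_def deg_def)

lemma normalized_vector:
  obtains f where "x = (\<chi> u. sqrt (deg u) * f u)"
proof
  show "x = (\<chi> u. sqrt (deg u) * (x $ u / sqrt (deg u)))"
    using deg_pos by (simp add: vec_eq_iff less_imp_neq[THEN not_sym])
qed

text \<open>Provides the lower bound under which the real infimum \<open>lambda_R\<close> lies below
  each quotient.\<close>

lemma rayleigh_nonneg: "0 \<le> (x \<bullet> (symmetrized_laplacian E B *v x)) / (x \<bullet> x)"
proof -
  obtain f where "x = (\<chi> u. sqrt (deg u) * f u)"
    by (rule normalized_vector)
  then show ?thesis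
    by (simp add: inner_laplacian energy_nonneg)
qed

lemma cheeger_R_le:
  assumes "S \<noteq> {}" "S \<noteq> UNIV"
  shows "cheeger_R E B \<le> cut S / min (volume S) (volume (- S))"
  unfolding cheeger_R_def edge_measure_eq_cut vol_eq_volume using assms by (intro Min_le) auto

lemma min_volume_pos:
  assumes "S \<noteq> {}" "S \<noteq> UNIV"
  shows "0 < min (volume S) (volume (- S))"
  using assms by (auto intro!: volume_pos)

lemma cheeger_R_attained:
  assumes "2 \<le> CARD('v)"
  obtains S where "S \<noteq> {}" "S \<noteq> UNIV"
    "cheeger_R E B = cut S / min (volume S) (volume (- S))"
proof -
  \<comment> \<open>With two vertices a singleton is a proper subset, so \<open>Min\<close> ranges
    over a nonempty set.\<close>
  have "card {undefined :: 'v} \<noteq> CARD('v)" using assms by simp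
  then have "{undefined :: 'v} \<noteq> UNIV" by metis
  then have "{S :: 'v set. S \<noteq> {} \<and> S \<noteq> UNIV} \<noteq> {}" by blast
  then have "cheeger_R E B \<in> (\<lambda>S. cut S / min (volume S) (volume (- S))) ` {S. S \<noteq> {} \<and> S \<noteq> UNIV}"
    unfolding cheeger_R_def edge_measure_eq_cut vol_eq_volume by (intro Min_in) auto
  then show thesis using that by auto
qed

lemma cheeger_R_nonneg:
  assumes "2 \<le> CARD('v)"
  shows "0 \<le> cheeger_R E B"
proof -
  obtain S where "S \<noteq> {}" "S \<noteq> UNIV" "cheeger_R E B = cut S / min (volume S) (volume (- S))"
    using assms by (rule cheeger_R_attained)
  then show ?thesis
    using min_volume_pos[of S] cut_nonneg[of S] by simp
qed

lemma lambda_R_le_cheeger_R: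
  assumes "2 \<le> CARD('v)"
  shows "lambda_R E B / 2 \<le> cheeger_R E B"
proof -
  obtain S where S: "S \<noteq> {}" "S \<noteq> UNIV" "cheeger_R E B = cut S / min (volume S) (volume (- S))"
    using assms by (rule cheeger_R_attained)
  obtain f where f: "(\<Sum>u\<in>UNIV. deg u * f u) = 0" "0 < (\<Sum>u\<in>UNIV. deg u * (f u)\<^sup>2)"
    "energy f * min (volume S) (volume (- S)) \<le> 4 * cut S * (\<Sum>u\<in>UNIV. deg u * (f u)\<^sup>2)"
    using S(1,2) by (rule cheeger_lower)
  define x where "x = (\<chi> u. sqrt (deg u) * f u)"
  have xx: "x \<bullet> x = (\<Sum>u\<in>UNIV. deg u * (f u)\<^sup>2)"
    unfolding x_def by (rule inner_self)
  have "x \<bullet> ground_vector E B = 0"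
    using f(1) by (simp add: x_def inner_ground)
  moreover have "x \<noteq> 0" using f(2) xx by auto
  ultimately have "lambda_R E B \<le> (x \<bullet> (symmetrized_laplacian E B *v x)) / (x \<bullet> x)"
    unfolding lambda_R_def
    by (intro cINF_lower bdd_belowI2[where m = 0] rayleigh_nonneg) simp
  also have "\<dots> = energy f / 2 / (\<Sum>u\<in>UNIV. deg u * (f u)\<^sup>2)"
    unfolding xx by (simp add: x_def inner_laplacian)
  \<comment> \<open>The 4 from \<open>cheeger_lower\<close> is halved by the factor in
    \<open>inner_laplacian\<close>.\<close>
  also have "\<dots> \<le> 2 * cheeger_R E B"
    unfolding S(3) using f(2,3) min_volume_pos[OF S(1,2)] by (simp add: divide_simps algebra_simps)
  finally show ?thesis by simp
qed

text \<open>Bounding the infimum from below requires a nonempty index set; the test function of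
  \<open>cheeger_lower\<close> supplies a member.\<close>

lemma nonzero_orthogonal_vector:
  assumes "2 \<le> CARD('v)"
  obtains x where "x \<noteq> 0" "x \<bullet> ground_vector E B = 0"
proof -
  obtain S where "S \<noteq> {}" "S \<noteq> UNIV" "cheeger_R E B = cut S / min (volume S) (volume (- S))"
    using assms by (rule cheeger_R_attained)
  then obtain f where f: "(\<Sum>u\<in>UNIV. deg u * f u) = 0" "0 < (\<Sum>u\<in>UNIV. deg u * (f u)\<^sup>2)"
    using cheeger_lower by blast
  show thesis
    using f that[of "\<chi> u. sqrt (deg u) * f u"] inner_self[of f] inner_ground[of f] by force
qed

lemma cheeger_R_le_lambda_R:
  assumes "2 \<le> CARD('v)"
  shows "(cheeger_R E B)\<^sup>2 / 2 \<le> lambda_R E B"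
  unfolding lambda_R_def
proof (rule cINF_greatest)
  show "{x. x \<noteq> 0 \<and> x \<bullet> ground_vector E B = 0} \<noteq> {}"
    using nonzero_orthogonal_vector[OF assms] by blast
next
  fix x assume "x \<in> {x. x \<noteq> 0 \<and> x \<bullet> ground_vector E B = 0}"
  then have x: "x \<noteq> 0" "x \<bullet> ground_vector E B = 0" by auto
  obtain f where f: "x = (\<chi> u. sqrt (deg u) * f u)"
    by (rule normalized_vector)
  have "(cheeger_R E B)\<^sup>2 * (x \<bullet> x) \<le> energy f"
    unfolding f inner_self
  proof (rule cheeger_upper)
    show "cheeger_R E B * min (volume S) (volume (- S)) \<le> cut S" if "S \<noteq> {}" "S \<noteq> UNIV" for S
      using cheeger_R_le[OF that] min_volume_pos[OF that] by (simp only: pos_le_divide_eq)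
    show "(\<Sum>u\<in>UNIV. deg u * f u) = 0"
      using x(2) by (simp add: f inner_ground)
  qed (rule cheeger_R_nonneg[OF assms])
  also have "energy f = 2 * (x \<bullet> (symmetrized_laplacian E B *v x))"
    by (simp add: f inner_laplacian)
  finally show "(cheeger_R E B)\<^sup>2 / 2 \<le> (x \<bullet> (symmetrized_laplacian E B *v x)) / (x \<bullet> x)"
    using x(1) by (simp add: pos_le_divide_eq)
qed

end

theorem theorem1p1:
  fixes E :: "'v::finite set set" and B :: "'v set"
  assumes "simple_graph E"
    and "CARD('v) \<ge> 2"
    and "no_isolated E"
  shows "sqrt (2 * lambda_R E B) \<ge> cheeger_R E B \<and> cheeger_R E B \<ge> lambda_R E B / 2"
proof
  show "sqrt (2 * lambda_R E B) \<ge> cheeger_R E B"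
    using cheeger_R_le_lambda_R[OF assms(3,2), of B] by (intro real_le_rsqrt) simp
  show "cheeger_R E B \<ge> lambda_R E B / 2"
    using assms(3,2) by (rule lambda_R_le_cheeger_R)
qed

end
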